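(* Let $(\mathcal M,\cdot)$ be a group such that the real linear space $\mathcal H=\operatorname{Hom}((\mathcal M,\cdot),(\mathbb R,+))$ of group homomorphisms into the additive reals is finite-dimensional, and let $\mathcal H^*$ be its (algebraic) dual space. Let $J\colon\mathcal M\to\mathcal H^*$, $J(x)=\delta_x$, where $\delta_x(\varphi)=\varphi(x)$ for $\varphi\in\mathcal H$. Let $f\colon\mathcal H^*\to\mathbb R\cup\{+\infty\}$ and $\psi=f\circ J\colon\mathcal M\to\mathbb R\cup\{+\infty\}$. (1) If $f$ is mid-point convex, then $$\psi(x)\le\tfrac12\bigl(\psi(y\cdot x)+\psi(y^{-1}\cdot x)\bigr)\qquad\text{for all }x,y\in\mathcal M.\tag{$*$}$$ (2) Conversely, if $\mathcal K:=\operatorname{range}J\subseteq\mathcal H^*$ is mid-point convex and $\psi$ satisfies $( * )$, then the restriction $f|_{\mathcal K}$ is mid-point convex.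
   Context: A subset $\mathcal K$ of a real linear space is mid-point convex if $x,y\in\mathcal K$ implies $\frac12(x+y)\in\mathcal K$. A function $f\colon\mathcal K\to\mathbb R\cup\{+\infty\}$ is mid-point convex if its epigraph $\{(x,c)\in\mathcal K\times\mathbb R: c\ge f(x)\}$ is mid-point convex. *)

theory Defs
  imports
    "HOL-Analysis.Product_Vector"
    "HOL-Library.Function_Algebras"
    "HOL-Library.Extended_Real"
    "HOL-Algebra.Group"
begin

text \<open>Pointwise scalar multiplication; together with the pointwise addition of
  \<^theory>\<open>HOL-Library.Function_Algebras\<close> it makes functions into a real vector space a
  real vector space.\<close>

instantiation "fun" :: (type, real_vector) real_vector
begin

definition scaleR_fun_def: "c *\<^sub>R f = (\<lambda>x. c *\<^sub>R f x)"

instance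
  by standard (simp_all add: scaleR_fun_def plus_fun_def fun_eq_iff scaleR_add_right scaleR_add_left)

end

definition finite_dimensional :: "'v::real_vector set \<Rightarrow> bool" where
  "finite_dimensional V \<longleftrightarrow> (\<exists>B. finite B \<and> span B = V)"

text \<open>The algebraic dual of a linear subspace \<open>V\<close>. A functional on \<open>V\<close> is represented by
  the function that is \<open>0\<close> outside \<open>V\<close>, so that functionals are equal as functions iff they
  agree on \<open>V\<close>, and the dual is again a linear subspace.\<close>

definition dual_space :: "'v::real_vector set \<Rightarrow> ('v \<Rightarrow> real) set" where
  "dual_space V =
    {l. (\<forall>u\<in>V. \<forall>v\<in>V. l (u + v) = l u + l v) \<and>
        (\<forall>c. \<forall>v\<in>V. l (c *\<^sub>R v) = c * l v) \<and>
        (\<forall>v. v \<notin> V \<longrightarrow> l v = 0)}"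

definition additive_real_group :: "real monoid" where
  "additive_real_group = \<lparr>carrier = UNIV, monoid.mult = (+), one = 0\<rparr>"

text \<open>Homomorphisms into the additive reals, as functions vanishing outside the carrier
  (same convention as for the dual).\<close>

definition real_hom :: "('a, 'b) monoid_scheme \<Rightarrow> ('a \<Rightarrow> real) set" where
  "real_hom G = {\<phi> \<in> hom G additive_real_group. \<forall>x. x \<notin> carrier G \<longrightarrow> \<phi> x = 0}"

definition eval_map :: "('a, 'b) monoid_scheme \<Rightarrow> 'a \<Rightarrow> ('a \<Rightarrow> real) \<Rightarrow> real" where
  "eval_map G x = (\<lambda>\<phi>. if \<phi> \<in> real_hom G then \<phi> x else 0)"

definition midpoint_convex :: "'v::real_vector set \<Rightarrow> bool" where
  "midpoint_convex K \<longleftrightarrow> (\<forall>x\<in>K. \<forall>y\<in>K. (1/2) *\<^sub>R (x + y) \<in> K)"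

text \<open>The second components of the epigraph are real numbers, so points with value \<open>\<infinity>\<close> do
  not contribute.\<close>

definition ereal_epigraph :: "'v set \<Rightarrow> ('v \<Rightarrow> ereal) \<Rightarrow> ('v \<times> real) set" where
  "ereal_epigraph K f = {(x, c). x \<in> K \<and> ereal c \<ge> f x}"

definition midpoint_convex_on :: "'v::real_vector set \<Rightarrow> ('v \<Rightarrow> ereal) \<Rightarrow> bool" where
  "midpoint_convex_on K f \<longleftrightarrow> midpoint_convex (ereal_epigraph K f)"

lemma group_additive_real_group: "group additive_real_group"
  by (rule groupI) (auto simp: additive_real_group_def intro: exI[of _ "- x" for x :: real])

lemma mem_real_hom_iff:
  "\<phi> \<in> real_hom G \<longleftrightarrow>
    (\<forall>x\<in>carrier G. \<forall>y\<in>carrier G. \<phi> (x \<otimes>\<^bsub>G\<^esub> y) = \<phi> x + \<phi> y) \<and>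
    (\<forall>x. x \<notin> carrier G \<longrightarrow> \<phi> x = 0)"
  by (auto simp: real_hom_def hom_def additive_real_group_def)

lemma subspace_real_hom: "group G \<Longrightarrow> subspace (real_hom G)"
  by (auto simp: subspace_def mem_real_hom_iff scaleR_fun_def algebra_simps)

lemma subspace_dual_space: "subspace V \<Longrightarrow> subspace (dual_space V)"
  by (auto simp: subspace_def dual_space_def scaleR_fun_def algebra_simps)

lemma eval_map_in_dual_space:
  assumes "group G"
  shows "eval_map G x \<in> dual_space (real_hom G)"
  using subspace_real_hom[OF assms]
  by (auto simp: dual_space_def eval_map_def scaleR_fun_def subspace_add subspace_scale
      dest: subspace_scale)

end

theory Submission
  imports Defs
begin

text \<open>The map \<open>J\<close> is additive, so \<open>J x\<close> is the midpoint of \<open>J (y x)\<close> and \<open>J (y\<^sup>-\<^sup>1 x)\<close>; this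
  gives (1). Conversely, if \<open>J z\<close> is the midpoint of \<open>J a\<close> and \<open>J b\<close>, take \<open>y = a z\<^sup>-\<^sup>1\<close>: then
  \<open>y z = a\<close>, while \<open>J (y\<^sup>-\<^sup>1 z) = 2 J z - J a = J b\<close> even though \<open>y\<^sup>-\<^sup>1 z\<close> need not equal \<open>b\<close>.
  Since \<open>\<psi>\<close> factors through \<open>J\<close>, this gives (2).\<close>

text \<open>Graph points with real values lie in the epigraph, hence so does their midpoint.
  Excluding \<open>- \<infinity>\<close> ensures that only real values remain once
  \<open>\<infinity>\<close> is treated separately.\<close>

lemma midpoint_convex_onD:
  assumes conv: "midpoint_convex_on K f" and K: "u \<in> K" "v \<in> K"
    and fin: "f u \<noteq> - \<infinity>" "f v \<noteq> - \<infinity>"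
  shows "f ((1/2) *\<^sub>R (u + v)) \<le> ereal (1/2) * (f u + f v)"
proof (cases "f u = \<infinity> \<or> f v = \<infinity>")
  case True
  \<comment> \<open>In \<open>ereal\<close> a sum with a summand \<open>\<infinity>\<close> is
    \<open>\<infinity>\<close>, so the bound is trivial.\<close>
  then show ?thesis by auto
next
  case False
  then obtain c d where cd: "f u = ereal c" "f v = ereal d"
    using fin by (metis ereal_cases)
  then have "(u, c) \<in> ereal_epigraph K f" "(v, d) \<in> ereal_epigraph K f"
    using K by (auto simp: ereal_epigraph_def)
  then have "(1/2) *\<^sub>R ((u, c) + (v, d)) \<in> ereal_epigraph K f"
    using conv unfolding midpoint_convex_on_def midpoint_convex_def by blast
  then show ?thesis
    by (simp add: ereal_epigraph_def cd)
qed

text \<open>Epigraph points may lie above the graph, so the bound in \<open>f u\<close> and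
  \<open>f v\<close> is relaxed to their heights by monotonicity; convexity of \<open>K\<close>
  keeps the midpoint in the domain.\<close>

lemma midpoint_convex_onI:
  assumes K: "midpoint_convex K"
    and f: "\<And>u v. u \<in> K \<Longrightarrow> v \<in> K \<Longrightarrow> f ((1/2) *\<^sub>R (u + v)) \<le> ereal (1/2) * (f u + f v)"
  shows "midpoint_convex_on K f"
proof -
  have "(1/2) *\<^sub>R ((u, c) + (v, d)) \<in> ereal_epigraph K f"
    if "(u, c) \<in> ereal_epigraph K f" "(v, d) \<in> ereal_epigraph K f" for u v c d
  proof -
    have uv: "u \<in> K" "v \<in> K" "f u \<le> ereal c" "f v \<le> ereal d"
      using that by (auto simp: ereal_epigraph_def)
    have "f ((1/2) *\<^sub>R (u + v)) \<le> ereal (1/2) * (f u + f v)"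
      using f uv by blast
    also have "\<dots> \<le> ereal (1/2) * (ereal c + ereal d)"
      using uv by (intro ereal_mult_left_mono add_mono) auto
    finally show ?thesis
      using K uv by (simp add: ereal_epigraph_def midpoint_convex_def)
  qed
  then show ?thesis
    by (auto simp: midpoint_convex_on_def midpoint_convex_def)
qed

text \<open>On \<open>real_hom G\<close> this is the homomorphism property; elsewhere all three
  functionals are 0 by convention.\<close>

lemma eval_map_mult:
  assumes "x \<in> carrier G" "y \<in> carrier G"
  shows "eval_map G (x \<otimes>\<^bsub>G\<^esub> y) = eval_map G x + eval_map G y"
  using assms by (auto simp: eval_map_def mem_real_hom_iff fun_eq_iff)

text \<open>Additivity applied to the factorization of \<open>x\<close> as \<open>y\<close> times
  \<open>inv y \<otimes> x\<close>.\<close>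

lemma (in group) eval_map_inv_mult:
  assumes "x \<in> carrier G" "y \<in> carrier G"
  shows "eval_map G (inv y \<otimes> x) = eval_map G x - eval_map G y"
proof -
  have "eval_map G x = eval_map G (y \<otimes> (inv y \<otimes> x))"
    using assms by (simp flip: m_assoc)
  also have "\<dots> = eval_map G y + eval_map G (inv y \<otimes> x)"
    using assms by (simp add: eval_map_mult)
  finally show ?thesis by simp
qed

theorem proposition6p8:
  fixes G :: "('a, 'b) monoid_scheme"
    and f :: "(('a \<Rightarrow> real) \<Rightarrow> real) \<Rightarrow> ereal"
    and \<psi> :: "'a \<Rightarrow> ereal"
  assumes "group G"
    and "finite_dimensional (real_hom G)"
    and "\<forall>l\<in>dual_space (real_hom G). f l \<noteq> - \<infinity>"
    and "\<forall>x\<in>carrier G. \<psi> x = f (eval_map G x)"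
  shows "(midpoint_convex_on (dual_space (real_hom G)) f \<longrightarrow>
            (\<forall>x\<in>carrier G. \<forall>y\<in>carrier G.
               \<psi> x \<le> ereal (1/2) * (\<psi> (y \<otimes>\<^bsub>G\<^esub> x) + \<psi> (inv\<^bsub>G\<^esub> y \<otimes>\<^bsub>G\<^esub> x)))) \<and>
         (midpoint_convex (eval_map G ` carrier G) \<and>
            (\<forall>x\<in>carrier G. \<forall>y\<in>carrier G.
               \<psi> x \<le> ereal (1/2) * (\<psi> (y \<otimes>\<^bsub>G\<^esub> x) + \<psi> (inv\<^bsub>G\<^esub> y \<otimes>\<^bsub>G\<^esub> x))) \<longrightarrow>
            midpoint_convex_on (eval_map G ` carrier G) f)"
proof (intro conjI impI; (elim conjE)?)
  interpret group G by fact
  show "\<forall>x\<in>carrier G. \<forall>y\<in>carrier G.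
      \<psi> x \<le> ereal (1/2) * (\<psi> (y \<otimes>\<^bsub>G\<^esub> x) + \<psi> (inv\<^bsub>G\<^esub> y \<otimes>\<^bsub>G\<^esub> x))"
    if conv: "midpoint_convex_on (dual_space (real_hom G)) f"
  proof (intro ballI)
    fix x y assume xy: "x \<in> carrier G" "y \<in> carrier G"
    let ?u = "eval_map G (y \<otimes>\<^bsub>G\<^esub> x)" and ?v = "eval_map G (inv\<^bsub>G\<^esub> y \<otimes>\<^bsub>G\<^esub> x)"
    have "?u + ?v = 2 *\<^sub>R eval_map G x"
      using xy by (simp add: eval_map_mult[of y G x] eval_map_inv_mult scaleR_2)
    \<comment> \<open>Both points lie in the dual space, where \<open>f\<close> avoids
      \<open>- \<infinity>\<close>.\<close>
    moreover have "f ((1/2) *\<^sub>R (?u + ?v)) \<le> ereal (1/2) * (f ?u + f ?v)"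
      using assms(3) eval_map_in_dual_space[OF assms(1)]
      by (intro midpoint_convex_onD[OF conv]) auto
    ultimately show "\<psi> x \<le> ereal (1/2) * (\<psi> (y \<otimes>\<^bsub>G\<^esub> x) + \<psi> (inv\<^bsub>G\<^esub> y \<otimes>\<^bsub>G\<^esub> x))"
      using xy assms(4) by simp
  qed
  show "midpoint_convex_on (eval_map G ` carrier G) f"
    if K: "midpoint_convex (eval_map G ` carrier G)"
      and \<psi>: "\<forall>x\<in>carrier G. \<forall>y\<in>carrier G.
        \<psi> x \<le> ereal (1/2) * (\<psi> (y \<otimes>\<^bsub>G\<^esub> x) + \<psi> (inv\<^bsub>G\<^esub> y \<otimes>\<^bsub>G\<^esub> x))"
  proof (rule midpoint_convex_onI[OF K])
    fix u v assume uv: "u \<in> eval_map G ` carrier G" "v \<in> eval_map G ` carrier G"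
    then obtain a where a: "a \<in> carrier G" "u = eval_map G a"
      by blast
    obtain z where z: "z \<in> carrier G" "(1/2) *\<^sub>R (u + v) = eval_map G z"
      using K uv unfolding midpoint_convex_def by blast
    define y where "y = a \<otimes>\<^bsub>G\<^esub> inv\<^bsub>G\<^esub> z"
    have y: "y \<in> carrier G" "y \<otimes>\<^bsub>G\<^esub> z = a"
      using a z by (auto simp: y_def m_assoc)
    have sum: "u + v = eval_map G z + eval_map G z"
      by (simp flip: z(2) scaleR_2)
    have "u = eval_map G y + eval_map G z"
      using eval_map_mult[OF y(1) z(1)] y(2) a(2) by simp
    \<comment> \<open>Both sums keep the same last summand, so that cancelling it leaves exactly the
      difference given by \<open>eval_map_inv_mult\<close>.\<close>
    then have "v = (eval_map G z + eval_map G z) - (eval_map G y + eval_map G z)"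
      by (simp flip: sum)
    then have "eval_map G (inv\<^bsub>G\<^esub> y \<otimes>\<^bsub>G\<^esub> z) = v"
      using y(1) z(1) by (simp only: add_diff_cancel_right eval_map_inv_mult)
    \<comment> \<open>The inequality for \<open>\<psi>\<close> at \<open>z\<close> and
      \<open>y\<close> becomes the claim: its three values are those of \<open>f\<close> at the
      midpoint, at \<open>u\<close> and at \<open>v\<close>.\<close>
    then show "f ((1/2) *\<^sub>R (u + v)) \<le> ereal (1/2) * (f u + f v)"
      using \<psi>[rule_format, OF z(1) y(1)] y a z assms(4) by simp
  qed
qed

end
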